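(* Fix a modulus $q\ge1$, a residue class $a\pmod q$, and an integer $R\ge1$. Then there is an arithmetic progression of integers $k$ such that, for all sufficiently large $k$ in the progression, $E_k$ contains at least $R$ distinct elements congruent to $a\pmod q$. In particular, $$\limsup_{k\to\infty}|E_k\cap(a+q\mathbb Z)|=\infty.$$
   Context: $\tau(n)$ is the number of positive divisors of $n$. For $k\ge2$ the exit set is $$E_k=\{\tau(k^2-j)-j:\ 1\le j\le 2k-2,\ \tau(k^2-j)\ge j\}.$$ *)

theory Defs
  imports "HOL-Number_Theory.Cong" "HOL-Library.Extended_Nat" "HOL-Library.Liminf_Limsup"
begin

text \<open>The divisor-counting function, meant for positive arguments: \<open>tau 0 = 0\<close> is a junk value,
  as \<open>card\<close> of an infinite set is \<open>0\<close>.\<close>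

definition tau :: "nat \<Rightarrow> nat" where
  "tau n = card {d. d dvd n}"

text \<open>Meant for \<open>k \<ge> 2\<close>. In the range of \<open>j\<close> one has \<open>k\<^sup>2 - j \<ge> (k - 1)\<^sup>2 + 1\<close>, so the
  subtractions on \<open>nat\<close> do not truncate.
  The elements are integers so that they can be compared with an arbitrary residue class.\<close>

definition exit_set :: "nat \<Rightarrow> int set" where
  "exit_set k = {int (tau (k\<^sup>2 - j)) - int j | j. 1 \<le> j \<and> j \<le> 2 * k - 2 \<and> tau (k\<^sup>2 - j) \<ge> j}"

end

theory Submission
  imports Defs
begin

text \<open>
  If a positive integer \<open>n\<close> is exactly divisible by \<open>p ^ (M - 1)\<close> for some prime \<open>p\<close>, then
  \<open>\<tau>(n)\<close> is a positive multiple of \<open>M\<close>. So the divisor counts of several numbers \<open>k\<^sup>2 - j\<close> can be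
  made multiples of one common modulus \<open>M\<close> by congruence conditions on \<open>k\<close>. When \<open>M\<close> is a multiple
  of \<open>q\<close> and exceeds all the \<open>j\<close> in question, this decides everything at once: the value
  \<open>\<tau>(k\<^sup>2 - j) - j\<close> is congruent to \<open>-j\<close> modulo \<open>q\<close>, so one takes \<open>j \<equiv> -a\<close>; the condition
  \<open>\<tau>(k\<^sup>2 - j) \<ge> j\<close> holds because \<open>\<tau>(k\<^sup>2 - j) \<ge> M\<close>; and different \<open>j\<close> give different values because
  these are congruent to \<open>-j\<close> modulo \<open>M\<close>. Between \<open>q\<close> and \<open>M = q (R + 1)\<close> there are exactly \<open>R\<close>
  such \<open>j\<close>.

  The congruence condition for a single \<open>j\<close> is \<open>k\<^sup>2 \<equiv> j + p ^ (M - 1)\<close> modulo \<open>p ^ M\<close>. It is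
  solvable for every odd prime \<open>p\<close> that does not divide \<open>j\<close> and modulo which \<open>j\<close> is a square, since
  square roots lift from \<open>p\<close> to its powers (\<open>square_root_lift\<close>). There are arbitrarily large
  primes of this kind (\<open>ex_large_prime_dvd_square_minus\<close>), so the \<open>j\<close> can be given different
  primes, and the Chinese remainder theorem combines the conditions into one residue class
  (\<open>ex_progression_dvd_tau\<close>).
\<close>

section \<open>Divisor counts\<close>

lemma tau_prime_power_mult:
  assumes p: "prime p" and m: "\<not> p dvd m"
  shows "tau (p ^ e * m) = Suc e * tau m"
proof -
  let ?f = "\<lambda>(i, d). p ^ i * d"
  have p1: "p > 1" using p by (rule prime_gt_1_nat)
  have cop: "coprime (p ^ i) d" if "d dvd m" for i d
    using p m that by (meson coprime_power_left_iff dvd_trans prime_imp_coprime)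
  have "inj_on ?f ({..e} \<times> {d. d dvd m})"
  proof (rule inj_onI, clarify)
    fix i d i' d'
    assume "d dvd m" "d' dvd m" and eq: "p ^ i * d = p ^ i' * d'"
    then have "p ^ i = p ^ i' \<and> d = d'"
      using cop[of d' i] cop[of d i'] coprime_crossproduct_nat[of "p ^ i" d' "p ^ i'" d] by simp
    then show "i = i' \<and> d = d'" using p1 by simp
  qed
  moreover have "?f ` ({..e} \<times> {d. d dvd m}) = {d. d dvd p ^ e * m}"
  proof (intro equalityI subsetI)
    fix x assume "x \<in> ?f ` ({..e} \<times> {d. d dvd m})"
    then show "x \<in> {d. d dvd p ^ e * m}"
      by (auto intro!: mult_dvd_mono le_imp_power_dvd)
  next
    fix x assume "x \<in> {d. d dvd p ^ e * m}"
    then obtain b c where "x = b * c" "b dvd p ^ e" "c dvd m"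
      using division_decomp by blast
    moreover then obtain i where "i \<le> e" "b = p ^ i"
      using divides_primepow_nat[OF p] by blast
    ultimately show "x \<in> ?f ` ({..e} \<times> {d. d dvd m})"
      by (auto intro!: image_eqI[where x = "(i, c)"])
  qed
  ultimately have "card {d. d dvd p ^ e * m} = card ({..e} \<times> {d. d dvd m})"
    by (metis card_image)
  then show ?thesis by (simp add: tau_def card_cartesian_product)
qed

text \<open>The congruence says that \<open>n\<close> is exactly divisible by the \<open>(M - 1)\<close>-st power of \<open>p\<close>.\<close>

lemma dvd_tau_if_cong_prime_power:
  assumes p: "prime p" and M: "M \<ge> 1" and n: "[n = p ^ (M - 1)] (mod p ^ M)"
  shows "M dvd tau n"
proof -
  obtain e where e: "M = Suc e" using M by (cases M) auto
  have "p ^ e < p ^ M" using prime_gt_1_nat[OF p] e by simp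
  then have "n mod p ^ M = p ^ e" using n e by (simp add: cong_def)
  then have "n = p ^ M * (n div p ^ M) + p ^ e"
    by (metis mult_div_mod_eq)
  then have "n = p ^ e * (p * (n div p ^ M) + 1)"
    by (simp add: e algebra_simps)
  moreover have "\<not> p dvd p * (n div p ^ M) + 1"
    using p by (metis dvd_add_right_iff dvd_triv_left not_prime_unit)
  ultimately have "tau n = M * tau (p * (n div p ^ M) + 1)"
    using tau_prime_power_mult[OF p] e by metis
  then show ?thesis by simp
qed

section \<open>Square roots modulo prime powers\<close>

text \<open>The step from \<open>p ^ n\<close> to \<open>p ^ (n + 1)\<close> is Hensel's: changing the root \<open>y\<close> by \<open>t p ^ n\<close> changes
  its square by \<open>2 y t p ^ n\<close> up to higher powers of \<open>p\<close>, and \<open>2 y\<close> is invertible modulo \<open>p\<close>.\<close>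

lemma square_root_lift:
  fixes p x c :: int
  assumes p: "prime p" "odd p" and x: "\<not> p dvd x" "[x\<^sup>2 = c] (mod p)"
  shows "\<exists>y. \<not> p dvd y \<and> [y\<^sup>2 = c] (mod p ^ Suc n)"
proof (induction n)
  case 0
  show ?case using x by auto
next
  case (Suc n)
  let ?P = "p ^ Suc n"
  obtain y where y: "\<not> p dvd y" "[y\<^sup>2 = c] (mod ?P)" using Suc by blast
  obtain u where u: "y\<^sup>2 = c + ?P * u"
    using y(2) by (metis cong_iff_dvd_diff dvd_def diff_eq_eq add.commute)
  have "\<not> p dvd 2"
    using p by (metis prime_int_numeral_eq primes_dvd_imp_eq two_is_prime_nat prime_nat_int_transfer of_nat_numeral even_numeral)
  then have "coprime (2 * y) p"
    using p y by (metis coprime_commute prime_dvd_multD prime_imp_coprime)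
  then obtain v where v: "[2 * y * v = 1] (mod p)"
    using cong_solve_coprime_int by blast
  define t where "t = - u * v"
  have "[u + 2 * y * v * (- u) = u + 1 * (- u)] (mod p)"
    by (intro cong_add cong_mult v cong_refl)
  then have "p dvd u + 2 * y * t"
    by (simp add: t_def cong_0_iff mult_ac)
  then have "p ^ Suc (Suc n) dvd ?P * (u + 2 * y * t)"
    by (simp add: mult_dvd_mono)
  moreover have "p ^ Suc (Suc n) dvd ?P * (?P * t\<^sup>2)"
    by (simp add: mult_dvd_mono)
  moreover have "(y + t * ?P)\<^sup>2 - c = ?P * (u + 2 * y * t) + ?P * (?P * t\<^sup>2)"
  proof -
    have "(y + t * ?P)\<^sup>2 - c = y\<^sup>2 - c + 2 * y * t * ?P + ?P * ?P * t\<^sup>2"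
      by (simp add: power2_eq_square algebra_simps)
    then show ?thesis unfolding u by (simp add: algebra_simps)
  qed
  ultimately have "[(y + t * ?P)\<^sup>2 = c] (mod p ^ Suc (Suc n))"
    unfolding cong_iff_dvd_diff by (metis dvd_add)
  moreover have "\<not> p dvd y + t * ?P"
    using y(1) by (simp add: dvd_add_left_iff)
  ultimately show ?case by blast
qed

text \<open>For \<open>x = j B!\<close> one has \<open>x\<^sup>2 - j = j (j (B!)\<^sup>2 - 1)\<close>. The second factor is coprime to \<open>j\<close> and
  to all numbers up to \<open>B\<close>, so that any of its prime factors will do.\<close>

lemma ex_large_prime_dvd_square_minus:
  fixes j B :: nat
  assumes j: "j \<ge> 1"
  shows "\<exists>p x. prime p \<and> p > B \<and> \<not> p dvd x \<and> [x\<^sup>2 = j] (mod p)"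
proof -
  (* The bound is raised to at least 2 so that the second factor is not 0 or 1. *)
  define F where "F = (fact (B + 2) :: nat)"
  define N where "N = j * F\<^sup>2 - 1"
  have F2: "F \<ge> 2"
    using fact_mono_nat[of 2 "B + 2"] by (simp add: F_def)
  have "2 * 2 \<le> F * F" using F2 F2 by (rule mult_le_mono)
  then have "1 * (2 * 2) \<le> j * (F * F)" using j by (intro mult_le_mono[of 1 j])
  then have N: "j * F\<^sup>2 = N + 1" "N > 1" by (auto simp: N_def power2_eq_square)
  obtain p where p: "prime p" "p dvd N"
    using N(2) prime_factor_nat by (metis less_irrefl)
  have ndvd: "\<not> p dvd j * F\<^sup>2"
    using p N(1) by (metis dvd_add_right_iff not_prime_unit)
  have "p > B"
  proof (rule ccontr)
    assume "\<not> p > B"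
    then have "p dvd F"
      using prime_gt_0_nat[OF p(1)] unfolding F_def by (intro dvd_fact) auto
    then show False using ndvd by (simp add: power2_eq_square)
  qed
  moreover have "\<not> p dvd j * F"
    using ndvd by (auto simp: power2_eq_square mult.assoc[symmetric])
  moreover have "[(j * F)\<^sup>2 = j] (mod p)"
  proof -
    have "(j * F)\<^sup>2 = j * (j * F\<^sup>2)" by (simp add: power2_eq_square algebra_simps)
    also have "\<dots> = j * N + j" by (simp add: N(1))
    finally show ?thesis using p(2) by (simp add: cong_def mod_add_left_eq[symmetric])
  qed
  ultimately show ?thesis using p(1) by blast
qed

section \<open>Progressions with prescribed divisibility\<close>

lemma ex_prime_power_class_dvd_tau:
  fixes j B M :: nat
  assumes j: "j \<ge> 1" and M: "M \<ge> 2"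
  shows "\<exists>p y. prime p \<and> p > B \<and>
           (\<forall>k. [k = y] (mod p ^ M) \<longrightarrow> j < k\<^sup>2 \<longrightarrow> M dvd tau (k\<^sup>2 - j))"
proof -
  (* The bound B + 2 excludes the prime 2, modulo whose powers square roots need not lift. *)
  obtain p x where p: "prime p" "p > B + 2" "\<not> p dvd x" "[x\<^sup>2 = j] (mod p)"
    using ex_large_prime_dvd_square_minus[OF j, of "B + 2"] by blast
  (* Modulo p the summand p ^ (M - 1) vanishes because M is at least 2, so c has the same square
     root x as j. *)
  define c where "c = j + p ^ (M - 1)"
  have "[j = c] (mod p)" using M by (simp add: c_def cong_def mod_add_right_eq[symmetric])
  then have "[x\<^sup>2 = c] (mod p)" using p(4) cong_trans by blast
  then have "[(int x)\<^sup>2 = int c] (mod int p)"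
    by (metis cong_int_iff of_nat_power)
  moreover have "odd (int p)" using p prime_odd_nat by auto
  ultimately obtain z where z: "[z\<^sup>2 = int c] (mod int p ^ Suc (M - 1))"
    using square_root_lift[of "int p" "int x" "int c" "M - 1"] p by auto
  define y where "y = nat (z mod int p ^ M)"
  have "int y = z mod int p ^ M"
    using prime_gt_0_nat[OF p(1)] by (simp add: y_def)
  then have "[(int y)\<^sup>2 = z\<^sup>2] (mod int p ^ M)"
    by (intro cong_pow) (simp add: cong_def)
  moreover have "[z\<^sup>2 = int c] (mod int p ^ M)" using z M by simp
  ultimately have "[int (y\<^sup>2) = int c] (mod int (p ^ M))"
    by (metis cong_trans of_nat_power)
  then have y: "[y\<^sup>2 = c] (mod p ^ M)" by (simp only: cong_int_iff)
  have "M dvd tau (k\<^sup>2 - j)" if k: "[k = y] (mod p ^ M)" "j < k\<^sup>2" for k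
  proof (rule dvd_tau_if_cong_prime_power[OF p(1)])
    have "[k\<^sup>2 = c] (mod p ^ M)" using k(1) y cong_pow cong_trans by blast
    moreover have "k\<^sup>2 = j + (k\<^sup>2 - j)" using k(2) by simp
    ultimately have "[j + (k\<^sup>2 - j) = j + p ^ (M - 1)] (mod p ^ M)"
      by (simp add: c_def)
    then show "[k\<^sup>2 - j = p ^ (M - 1)] (mod p ^ M)"
      by (simp only: cong_add_lcancel_nat)
  qed (use M in simp)
  then show ?thesis using p by (meson add_lessD1)
qed

text \<open>Each new \<open>j\<close> gets a prime that exceeds the modulus built so far and is therefore coprime to
  it.\<close>

lemma ex_progression_dvd_tau:
  fixes J :: "nat set" and M :: nat
  assumes "finite J" and pos: "\<forall>j\<in>J. j \<ge> 1" and M: "M \<ge> 2"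
  shows "\<exists>b d. d \<ge> 1 \<and>
           (\<forall>k. [k = b] (mod d) \<longrightarrow> (\<forall>j\<in>J. j < k\<^sup>2 \<longrightarrow> M dvd tau (k\<^sup>2 - j)))"
  using assms(1) pos
proof (induction J rule: finite_induct)
  case empty
  show ?case by auto
next
  case (insert j J)
  then obtain b d where d: "d \<ge> 1"
    and bd: "\<And>k i. [k = b] (mod d) \<Longrightarrow> i \<in> J \<Longrightarrow> i < k\<^sup>2 \<Longrightarrow> M dvd tau (k\<^sup>2 - i)"
    by (metis insertCI)
  have "j \<ge> 1" using insert.prems by simp
  then obtain p y where p: "prime p" "p > d"
    and py: "\<And>k. [k = y] (mod p ^ M) \<Longrightarrow> j < k\<^sup>2 \<Longrightarrow> M dvd tau (k\<^sup>2 - j)"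
    using ex_prime_power_class_dvd_tau[of j M d] M by blast
  have "\<not> p dvd d" using p d by (auto dest: dvd_imp_le)
  then have cop: "coprime d (p ^ M)"
    using p(1) by (metis coprime_commute coprime_power_right_iff prime_imp_coprime)
  obtain b' where b': "[b' = b] (mod d)" "[b' = y] (mod p ^ M)"
    using binary_chinese_remainder_nat[OF cop] by blast
  show ?case
  proof (rule exI[of _ b'], rule exI[of _ "d * p ^ M"], intro conjI allI impI ballI)
    show "d * p ^ M \<ge> 1" using d prime_gt_0_nat[OF p(1)] by simp
  next
    fix k i
    assume k: "[k = b'] (mod d * p ^ M)" and i: "i \<in> insert j J" "i < k\<^sup>2"
    have "[k = b] (mod d)"
      using k b'(1) by (meson cong_modulus_mult_nat cong_trans)
    moreover have "[k = y] (mod p ^ M)"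
      using k b'(2) by (metis cong_modulus_mult_nat cong_trans mult.commute)
    ultimately show "M dvd tau (k\<^sup>2 - i)" using i bd py by auto
  qed
qed

section \<open>The exit set\<close>

lemma finite_exit_set: "finite (exit_set k)"
proof -
  have "exit_set k \<subseteq> (\<lambda>j. int (tau (k\<^sup>2 - j)) - int j) ` {..2 * k - 2}"
    by (auto simp: exit_set_def)
  then show ?thesis by (rule finite_subset) simp
qed

lemma tau_pos: "n > 0 \<Longrightarrow> tau n > 0"
  by (auto simp: tau_def card_gt_0_iff)

text \<open>Since \<open>tau\<close> vanishes modulo \<open>M\<close> at each \<open>k\<^sup>2 - j\<close> and the \<open>j\<close> lie below \<open>M\<close>, the values at
  different \<open>j\<close> stay different.\<close>

lemma card_exit_set_residue_ge:
  fixes q a :: int and J :: "nat set" and M k :: nat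
  assumes J: "\<And>j. j \<in> J \<Longrightarrow> 1 \<le> j \<and> j < M \<and> [int j = - a] (mod q)"
    and q: "q dvd int M" and k: "k > M"
    and tau: "\<And>j. j \<in> J \<Longrightarrow> M dvd tau (k\<^sup>2 - j)"
  shows "card J \<le> card {e \<in> exit_set k. [e = a] (mod q)}"
proof -
  let ?f = "\<lambda>j. int (tau (k\<^sup>2 - j)) - int j"
  have kk: "j < k\<^sup>2" if "j \<in> J" for j
    using J[OF that] k self_le_power[of k 2] by linarith
  have "inj_on ?f J"
  proof (rule inj_onI)
    fix i j assume ij: "i \<in> J" "j \<in> J" "?f i = ?f j"
    have "int M dvd int (tau (k\<^sup>2 - i)) - int (tau (k\<^sup>2 - j))"
      using tau ij by (intro dvd_diff) auto
    moreover have "int (tau (k\<^sup>2 - i)) - int (tau (k\<^sup>2 - j)) = int i - int j"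
      using ij(3) by linarith
    ultimately have "int M dvd int i - int j" by simp
    then have "[i = j] (mod M)" by (simp add: cong_iff_dvd_diff flip: cong_int_iff)
    then show "i = j" using J ij by (meson cong_less_modulus_unique_nat)
  qed
  moreover have "?f ` J \<subseteq> {e \<in> exit_set k. [e = a] (mod q)}"
  proof clarify
    fix j assume j: "j \<in> J"
    have "tau (k\<^sup>2 - j) \<ge> M"
      using tau[OF j] tau_pos kk[OF j] by (meson dvd_imp_le zero_less_diff)
    then have "?f j \<in> exit_set k"
      using J[OF j] k by (auto simp: exit_set_def)
    moreover have "q dvd int (tau (k\<^sup>2 - j))"
      using q tau[OF j] by (meson dvd_trans int_dvd_int_iff)
    then have "[?f j = 0 - (- a)] (mod q)"
      using J[OF j] by (intro cong_diff) (auto simp: cong_0_iff)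
    ultimately show "?f j \<in> exit_set k \<and> [?f j = a] (mod q)" by simp
  qed
  ultimately show ?thesis
    using card_inj_on_le[of ?f J] finite_exit_set by simp
qed

lemma ex_progression_card_exit_set:
  fixes q a :: int and R :: nat
  assumes q: "q \<ge> 1" and R: "R \<ge> 1"
  shows "\<exists>b d :: nat. d \<ge> 1 \<and>
           (\<forall>\<^sub>F k in sequentially. [k = b] (mod d) \<longrightarrow>
              card {e \<in> exit_set k. [e = a] (mod q)} \<ge> R)"
proof -
  define Q where "Q = nat q"
  define r where "r = nat ((- a) mod q)"
  define M where "M = Q * (R + 1)"
  define J where "J = (\<lambda>i. r + Q * Suc i) ` {..<R}"
  have Q: "int Q = q" "Q \<ge> 1" using q by (auto simp: Q_def)
  have r: "int r = (- a) mod q" using q by (simp add: r_def)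
  have rQ: "r < Q" using q pos_mod_bound[of q "- a"] by (simp add: Q_def r_def)
  have "1 * 2 \<le> Q * (R + 1)" using Q R by (intro mult_le_mono) auto
  then have M: "M \<ge> 2" by (simp add: M_def)
  have "card J = R"
    using Q by (simp add: J_def card_image inj_on_def)
  have J: "1 \<le> j \<and> j < M \<and> [int j = - a] (mod q)" if "j \<in> J" for j
  proof -
    obtain i where i: "i < R" "j = r + Q * Suc i" using \<open>j \<in> J\<close> unfolding J_def by blast
    have "Q * Suc i \<le> Q * R" using i by (intro mult_le_mono) auto
    then have "j < M" using i(2) rQ by (simp add: M_def)
    moreover have "[int j = - a] (mod q)"
      using i(2) by (simp add: cong_def Q r mod_add_left_eq del: of_nat_Suc mult_Suc_right)
    ultimately show ?thesis using i(2) Q(2) by simp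
  qed
  have "finite J" by (simp add: J_def)
  then obtain b d where d: "d \<ge> 1"
    and bd: "\<And>k j. [k = b] (mod d) \<Longrightarrow> j \<in> J \<Longrightarrow> j < k\<^sup>2 \<Longrightarrow> M dvd tau (k\<^sup>2 - j)"
    using ex_progression_dvd_tau[of J M] J M by blast
  have "R \<le> card {e \<in> exit_set k. [e = a] (mod q)}" if "k > M" "[k = b] (mod d)" for k
  proof -
    have "M dvd tau (k\<^sup>2 - j)" if "j \<in> J" for j
      using bd[OF \<open>[k = b] (mod d)\<close> that] J[OF that] \<open>k > M\<close> self_le_power[of k 2] by simp
    moreover have "q dvd int M" by (simp add: M_def Q)
    ultimately show ?thesis
      using card_exit_set_residue_ge[of J M a q k] J \<open>k > M\<close> \<open>card J = R\<close> by blast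
  qed
  then have "\<forall>\<^sub>F k in sequentially. [k = b] (mod d) \<longrightarrow>
      R \<le> card {e \<in> exit_set k. [e = a] (mod q)}"
    by (intro eventually_sequentiallyI[of "Suc M"]) auto
  then show ?thesis using d by blast
qed

lemma limsup_enat_eq_infinity:
  fixes f :: "nat \<Rightarrow> nat"
  assumes "\<And>R n. \<exists>k\<ge>n. R \<le> f k"
  shows "limsup (\<lambda>k. enat (f k)) = \<infinity>"
proof -
  have "enat R \<le> limsup (\<lambda>k. enat (f k))" for R
    unfolding limsup_INF_SUP
  proof (rule INF_greatest)
    fix n
    obtain k where "k \<ge> n" "R \<le> f k" using assms by blast
    then show "enat R \<le> (SUP m\<in>{n..}. enat (f m))"
      by (intro SUP_upper2[of k]) auto
  qed
  then show ?thesis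
    by (metis enat.exhaust enat_ord_simps(1) not_less_eq_eq order_refl)
qed

theorem theorem7p2:
  fixes q a :: int
  assumes "q \<ge> 1"
  shows "(\<forall>R::nat. R \<ge> 1 \<longrightarrow>
           (\<exists>b d :: nat. d \<ge> 1 \<and>
             (\<forall>\<^sub>F k in sequentially. [k = b] (mod d) \<longrightarrow>
                card {e \<in> exit_set k. [e = a] (mod q)} \<ge> R)))
       \<and> limsup (\<lambda>k. enat (card (exit_set k \<inter> {a + q * t | t :: int. True}))) = \<infinity>"
proof (intro conjI allI impI)
  fix R :: nat assume "R \<ge> 1"
  with assms show "\<exists>b d :: nat. d \<ge> 1 \<and>
      (\<forall>\<^sub>F k in sequentially. [k = b] (mod d) \<longrightarrow>
         card {e \<in> exit_set k. [e = a] (mod q)} \<ge> R)"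
    by (rule ex_progression_card_exit_set)
next
  have "[e = a] (mod q) \<longleftrightarrow> (\<exists>t. e = a + q * t)" for e
    by (metis cong_iff_lin cong_sym_eq)
  then have set_eq: "exit_set k \<inter> {a + q * t | t :: int. True} = {e \<in> exit_set k. [e = a] (mod q)}" for k
    by auto
  show "limsup (\<lambda>k. enat (card (exit_set k \<inter> {a + q * t | t :: int. True}))) = \<infinity>"
    unfolding set_eq
  proof (rule limsup_enat_eq_infinity)
    fix R n :: nat
    obtain b d k0 where d: "d \<ge> 1"
      and k0: "\<And>k. k \<ge> k0 \<Longrightarrow> [k = b] (mod d) \<Longrightarrow>
                 Suc R \<le> card {e \<in> exit_set k. [e = a] (mod q)}"
      using ex_progression_card_exit_set[OF assms, of "Suc R" a]
      by (auto simp: eventually_sequentially)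
    define k where "k = b + d * (n + k0)"
    have "n + k0 \<le> k"
      unfolding k_def using d by (intro trans_le_add2) (cases d; simp)
    then have "n \<le> k" "k0 \<le> k" by simp_all
    moreover have "[k = b] (mod d)" by (simp add: k_def cong_def)
    ultimately show "\<exists>k\<ge>n. R \<le> card {e \<in> exit_set k. [e = a] (mod q)}"
      using k0[of k] by (intro exI[of _ k]) auto
  qed
qed

end
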